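(* For every positive integer $m$ there is a supersequence of size (length) $$\left\lceil m^2-\frac52 m+\frac32\left(\frac m2\right)^{2/3}+\left(\frac m2\right)^{1/3}+7\right\rceil$$ over a set of $m$ letters.
   Context: A supersequence over a finite set $A$ is a finite sequence of elements of $A$ that contains every permutation of $A$ (every sequence listing each element of $A$ exactly once) as a subsequence, i.e. each permutation can be obtained from it by deleting zero or more elements and keeping the order of the others. The size of a sequence is its length. *)

theory Defs
  imports Complex_Main "HOL-Library.Sublist" "HOL-Combinatorics.Multiset_Permutations"
begin

definition supersequence :: "'a set \<Rightarrow> 'a list \<Rightarrow> bool" where
  "supersequence A w \<longleftrightarrow>
     finite A \<and> set w \<subseteq> A \<and> (\<forall>p\<in>permutations_of_set A. subseq p w)"

end

theory Submission
  imports Defs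
begin

text \<open>
  Three letters (the specials) are set aside and the other \<open>n = N + 1\<close> letters are written
  cyclically.  In the cyclic word the next letter of a permutation is always found within \<open>N\<close> steps,
  or within \<open>N + 1\<close> steps if a special letter was read in between.  Hence, measuring positions as
  \<open>i * N + s\<close> (tick \<open>i\<close>, slot \<open>s\<close>), an ordinary letter advances the tick by one and each special
  letter may additionally increase the slot by one.  The specials are placed in slots 2, 3, 4 of
  every even tick, and in slots 1, 2, 4, 5 of every odd tick, the middle one taking both outer
  slots.  With this pattern the three specials together delay a permutation by at most one tick,
  whatever their order, at an average cost of 7/2 extra letters per tick.  This gives length at
  most \<open>m\<^sup>2 - 5/2 m + 21/2\<close>.  For \<open>m \<le> 7\<close> the cyclic word of length \<open>m\<^sup>2 - m + 1\<close> is short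
  enough.
\<close>

text \<open>The theorem asks for an exact length, while the constructions only give upper bounds.
  Appended letters destroy no embedding.\<close>

lemma supersequence_pad:
  assumes "supersequence A w" "a \<in> A" "length w \<le> l"
  shows "\<exists>w. supersequence A w \<and> length w = l"
proof (intro exI conjI)
  let ?w = "w @ replicate (l - length w) a"
  show "length ?w = l" using assms(3) by simp
  show "supersequence A ?w"
    using assms(1,2) unfolding supersequence_def
    by (auto intro: list_emb_append2 simp: set_replicate_conv_if)
qed

subsection \<open>Cyclic words\<close>

lemma cyclic_next:
  assumes "u \<in> set xs"
  shows "\<exists>t\<ge>q. t < q + length xs \<and> xs ! (t mod length xs) = u"
proof -
  obtain i where i: "i < length xs" "xs ! i = u" using assms by (auto simp: in_set_conv_nth)
  let ?n = "length xs"
  have n: "?n > 0" using i(1) by linarith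
  \<comment> \<open>Adding \<open>?n - q mod ?n\<close> replaces subtracting
    \<open>q mod ?n\<close>, which could truncate at zero.\<close>
  let ?t = "q + (i + (?n - q mod ?n)) mod ?n"
  have "?t mod ?n = (q mod ?n + (i + (?n - q mod ?n))) mod ?n"
    by (metis mod_add_eq mod_add_left_eq mod_add_right_eq)
  also have "q mod ?n + (i + (?n - q mod ?n)) = i + ?n"
    using mod_less_divisor[OF n, of q] by linarith
  finally have "?t mod ?n = i" using i by simp
  moreover have "?t < q + ?n" using n by simp
  ultimately show ?thesis using i by (intro exI[of _ ?t]) simp
qed

lemma map_upt_split:
  assumes "a \<le> t" "t < b"
  shows "map c [a..<b] = map c [a..<t] @ c t # map c [Suc t..<b]"
  using assms by (metis le_add_diff_inverse less_imp_le_nat list.simps(9) map_append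
      upt_add_eq_append upt_conv_Cons)

lemma subseq_map_upt_extend:
  assumes "subseq us (map c [a..<b])" "b \<le> b'"
  shows "subseq us (map c [a..<b'])"
proof (cases "a \<le> b")
  case True
  then have "[a..<b'] = [a..<b] @ [b..<b']"
    using assms(2) by (metis le_add_diff_inverse upt_add_eq_append)
  then show ?thesis using assms(1) by (simp add: list_emb_prefix)
qed (cases us; use assms(1) in auto)

lemma subseq_map_upt_Cons:
  assumes "a \<le> t" "c t = u" "subseq us (map c [Suc t..<b])" "t < b"
  shows "subseq (u # us) (map c [a..<b])"
  unfolding map_upt_split[OF assms(1,4)] using assms(2,3)
  by (simp add: list_emb_append2)

text \<open>A letter different from \<open>c q\<close> is met at most \<open>length xs - 1\<close>
  positions after \<open>q\<close>. As \<open>us\<close> is distinct, the letter just read does not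
  recur in the rest, so the saving repeats at every letter.\<close>

lemma cyclic_subseq_step:
  fixes xs :: "'a list"
  defines "c \<equiv> \<lambda>t. xs ! (t mod length xs)"
  assumes "distinct us" "set us \<subseteq> set xs" "c q \<notin> set us"
  shows "subseq us (map c [Suc q..<Suc q + length us * (length xs - 1)])"
  using assms(2-)
proof (induction us arbitrary: q)
  case (Cons u us)
  obtain t where t: "t \<ge> q" "t < q + length xs" "c t = u"
    using cyclic_next[of u xs q] Cons.prems by (auto simp: c_def)
  have "t \<noteq> q" using t(3) Cons.prems(3) by auto
  then have t': "Suc q \<le> t" using t(1) by simp
  have "subseq us (map c [Suc t..<Suc t + length us * (length xs - 1)])"
    using Cons t(3) by auto
  then have "subseq us (map c [Suc t..<Suc q + length (u # us) * (length xs - 1)])"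
    using t(2) by (elim subseq_map_upt_extend) simp
  then show ?case
    using t t' by (intro subseq_map_upt_Cons[of _ t]) auto
qed simp

text \<open>Here nothing excludes \<open>c q\<close>, so the first letter may cost a full period;
  this is the \<open>Suc\<close> in the bound.\<close>

lemma cyclic_subseq:
  fixes xs :: "'a list"
  defines "c \<equiv> \<lambda>t. xs ! (t mod length xs)"
  assumes "distinct us" "set us \<subseteq> set xs"
  shows "subseq us (map c [q..<Suc q + length us * (length xs - 1)])"
proof (cases us)
  case (Cons u vs)
  obtain t where t: "t \<ge> q" "t < q + length xs" "c t = u"
    using cyclic_next[of u xs q] assms Cons by (auto simp: c_def)
  have "subseq vs (map c [Suc t..<Suc t + length vs * (length xs - 1)])"
    unfolding c_def
    by (rule cyclic_subseq_step) (use assms Cons t(3) in \<open>auto simp: c_def\<close>)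
  then have "subseq vs (map c [Suc t..<Suc q + length us * (length xs - 1)])"
    using t(2) Cons by (elim subseq_map_upt_extend) simp
  then show ?thesis
    unfolding Cons using t by (intro subseq_map_upt_Cons[of _ t]) auto
qed simp

lemma supersequence_cyclic:
  assumes "finite A" "A \<noteq> {}"
  shows "\<exists>w. supersequence A w \<and> length w = 1 + card A * (card A - 1)"
proof -
  obtain xs where xs: "set xs = A" "distinct xs" using finite_distinct_list[OF assms(1)] by auto
  have n: "length xs = card A" using xs distinct_card by fastforce
  then have pos: "length xs > 0" using assms by (simp add: card_gt_0_iff)
  let ?w = "map (\<lambda>t. xs ! (t mod length xs)) [0..<Suc 0 + card A * (card A - 1)]"
  have "subseq p ?w" if "p \<in> permutations_of_set A" for p
  proof -
    have "distinct p" "set p = A" using that by (auto simp: permutations_of_set_def)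
    then show ?thesis using cyclic_subseq[of p xs 0] xs n distinct_card[of p] by simp
  qed
  moreover have "xs ! (t mod length xs) \<in> A" for t
    using nth_mem[of "t mod length xs" xs] pos xs(1) by simp
  then have "set ?w \<subseteq> A" by auto
  ultimately have "supersequence A ?w" using assms(1) by (simp add: supersequence_def)
  then show ?thesis by (intro exI[of _ ?w]) simp
qed

subsection \<open>Inserting special letters\<close>

text \<open>Positions count only the letters \<open>c t\<close>. The letters \<open>sp t\<close> sit
  just before \<open>c t\<close>, so inserting specials shifts no position.\<close>

definition interleave :: "(nat \<Rightarrow> 'a list) \<Rightarrow> (nat \<Rightarrow> 'a) \<Rightarrow> nat \<Rightarrow> 'a list" where
  "interleave sp c q = concat (map (\<lambda>t. sp t @ [c t]) [0..<q])"

lemma interleave_split: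
  assumes "q < t"
  shows "interleave sp c t
    = interleave sp c q @ sp q @ c q # concat (map (\<lambda>t. sp t @ [c t]) [Suc q..<t])"
proof -
  have "[0..<t] = [0..<q] @ q # [Suc q..<t]"
    using assms by (metis le_add_diff_inverse less_imp_le_nat less_nat_zero_code linorder_not_le
        upt_add_eq_append
        upt_conv_Cons)
  then show ?thesis by (simp add: interleave_def)
qed

lemma interleave_extend:
  assumes "subseq p (interleave sp c t)" "t \<le> q"
  shows "subseq p (interleave sp c q)"
  using assms by (cases "t = q") (auto simp: interleave_split[of t q] list_emb_prefix)

lemma subseq_concat_chunks:
  "subseq (map c ts) (concat (map (\<lambda>t. sp t @ [c t]) ts))"
proof (induction ts)
  case (Cons t ts)
  then have "subseq (c t # map c ts) (c t # concat (map (\<lambda>t. sp t @ [c t]) ts))" by simp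
  then show ?case by (simp add: list_emb_append2)
qed simp

lemma interleave_special:
  assumes "subseq p (interleave sp c t)" "t \<le> q" "a \<in> set (sp q)"
  shows "subseq (p @ [a]) (interleave sp c q @ sp q)"
proof (rule list_emb_append_mono)
  show "subseq p (interleave sp c q)" using assms(1,2) by (rule interleave_extend)
  show "subseq [a] (sp q)" using assms(3) by (simp add: subseq_singleton_left)
qed

text \<open>After a special read in \<open>sp q\<close> the letter \<open>c q\<close> is still
  ahead, so the next run may start at \<open>q\<close> itself.\<close>

lemma interleave_ordinary:
  assumes "subseq p (interleave sp c q @ sp q)" "q < t" "subseq us (map c [q..<t])"
  shows "subseq (p @ us) (interleave sp c t)"
proof -
  have "subseq us (c q # concat (map (\<lambda>t. sp t @ [c t]) [Suc q..<t]))"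
  proof (rule subseq_order.trans)
    show "subseq us (c q # map c [Suc q..<t])"
      using assms(2,3) by (simp add: upt_conv_Cons)
    show "subseq (c q # map c [Suc q..<t])
        (c q # concat (map (\<lambda>t. sp t @ [c t]) [Suc q..<t]))"
      using subseq_concat_chunks by simp
  qed
  with assms(1) have "subseq (p @ us) ((interleave sp c q @ sp q)
      @ c q # concat (map (\<lambda>t. sp t @ [c t]) [Suc q..<t]))"
    by (rule list_emb_append_mono)
  then show ?thesis by (simp add: interleave_split[OF assms(2)])
qed

lemma length_interleave: "length (interleave sp c q) = q + (\<Sum>t<q. length (sp t))"
  by (induction q) (auto simp: interleave_def)

subsection \<open>The placement of the special letters\<close>

definition slots :: "nat \<Rightarrow> nat \<Rightarrow> nat set" where
  "slots e i = (if e = 0 then {2} else if e = 1 then (if even i then {3} else {1, 5}) else {4})"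

text \<open>The slot \<open>s\<close> is an offset that may exceed \<open>N\<close>: for
  \<open>N = 4\<close>, slot 5 coincides with slot 1 of the next tick. Ticks up to
  \<open>N + 2\<close> suffice for \<open>N + 1\<close> ordinary letters and one tick of
  delay.\<close>

definition spots :: "nat \<Rightarrow> nat \<Rightarrow> nat set" where
  "spots N e = (\<lambda>(i, s). i * N + s) ` (SIGMA i:{..N + 2}. slots e i)"

lemma finite_slots: "finite (slots e i)"
  by (simp add: slots_def)

lemma finite_spots: "finite (spots N e)"
  by (simp add: spots_def finite_slots)

lemma spotsI: "s \<in> slots e i \<Longrightarrow> i \<le> N + 2 \<Longrightarrow> i * N + s \<in> spots N e"
  by (force simp: spots_def)

lemma card_spots: "2 * (card (spots N 0) + card (spots N 1) + card (spots N 2)) \<le> 7 * (N + 3)"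
proof -
  have le: "card (spots N e) \<le> (\<Sum>i\<le>N + 2. card (slots e i))" for e
    unfolding spots_def
    by (rule order.trans[OF card_image_le]) (auto simp: finite_slots)
  \<comment> \<open>Even ticks carry 3 letters and odd ticks 4; the last summand corrects for an
    unpaired even tick at the end.\<close>
  have parity: "2 * (\<Sum>i\<le>k. if even i then 3 else 4) + (if even k then 1 else 0) = 7 * Suc k"
    for k :: nat
    by (induction k) auto
  have "card (spots N 0) + card (spots N 1) + card (spots N 2)
      \<le> (\<Sum>i\<le>N + 2. card (slots 0 i) + card (slots 1 i) + card (slots 2 i))"
    using le[of 0] le[of 1] le[of 2] by (simp add: sum.distrib)
  also have "\<dots> = (\<Sum>i\<le>N + 2. if even i then 3 else 4)"
    by (intro sum.cong) (auto simp: slots_def)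
  finally show ?thesis using parity[of "N + 2"] by simp
qed

text \<open>The numbers \<open>r0\<close>, \<open>r1\<close>, \<open>r2\<close> are the lengths of
  the ordinary runs preceding each special. A run costs its length in ticks, and each special costs
  one slot, so relative to the undelayed tick the slots must increase strictly, a delay of one tick
  counting as \<open>N\<close> slots. In each of the six orders a choice by parity achieves this
  with at most one tick of delay.\<close>

lemma slots_schedule:
  assumes "N \<ge> 4" "{e0, e1, e2} = {0, 1, 2 :: nat}"
  shows "\<exists>i s j t k u. s \<in> slots e0 i \<and> t \<in> slots e1 j \<and> u \<in> slots e2 k
    \<and> r0 * N + 1 \<le> i * N + s \<and> i * N + s + 1 + r1 * N \<le> j * N + t
    \<and> j * N + t + 1 + r2 * N \<le> k * N + u
    \<and> k * N + u \<le> (r0 + r1 + r2 + 1) * N + 5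
    \<and> i \<le> r0 + r1 + r2 + 1 \<and> j \<le> r0 + r1 + r2 + 1 \<and> k \<le> r0 + r1 + r2 + 1"
    (is "\<exists>i s j t k u. ?P i s j t k u")
proof -
  \<comment> \<open>The undelayed ticks; every \<open>+ 1\<close> in a witness below is the
    delay.\<close>
  let ?i = r0 and ?j = "r0 + r1" and ?k = "r0 + r1 + r2"
  note defs = slots_def algebra_simps
  consider "e0 = 0" "e1 = 1" "e2 = 2" | "e0 = 0" "e1 = 2" "e2 = 1" | "e0 = 1" "e1 = 0" "e2 = 2"
    | "e0 = 1" "e1 = 2" "e2 = 0" | "e0 = 2" "e1 = 0" "e2 = 1" | "e0 = 2" "e1 = 1" "e2 = 0"
  proof -
    have "e0 \<in> {0, 1, 2}" "e1 \<in> {0, 1, 2}" "e2 \<in> {0, 1, 2}"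
      unfolding assms(2)[symmetric] by simp_all
    moreover have "e0 \<noteq> e1" "e1 \<noteq> e2" "e0 \<noteq> e2"
      using arg_cong[OF assms(2), of card] by (auto simp: card_insert_if split: if_splits)
    ultimately show thesis using that by auto
  qed
  then show ?thesis
  proof cases
    case 1
    then have "?P ?i 2 ?j (if even ?j then 3 else 5) (?k + 1) 4"
      using assms(1) by (auto simp: defs)
    then show ?thesis by blast
  next
    case 2
    \<comment> \<open>Slot 4 must be followed by slot 5 or later. For even \<open>?k\<close> the
      middle special next stands in slot 1 of tick \<open>?k + 1\<close>, which is late enough
      exactly because \<open>N >= 4\<close>.\<close>
    then have "if even ?k then ?P ?i 2 ?j 4 (?k + 1) 1 else ?P ?i 2 ?j 4 ?k 5"
      using assms(1) by (auto simp: defs)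
    then show ?thesis by (metis (full_types))
  next
    case 3
    then have "if even ?i then ?P ?i 3 (?j + 1) 2 (?k + 1) 4 else ?P ?i 1 ?j 2 ?k 4"
      using assms(1) by (auto simp: defs)
    then show ?thesis by (metis (full_types))
  next
    case 4
    then have "?P ?i (if even ?i then 3 else 1) ?j 4 (?k + 1) 2"
      using assms(1) by (auto simp: defs)
    then show ?thesis by blast
  next
    case 5
    then have "?P ?i 4 (?j + 1) 2 (?k + 1) (if even (?k + 1) then 3 else 5)"
      using assms(1) by (auto simp: defs)
    then show ?thesis by blast
  next
    case 6
    then have "if even ?j then ?P ?i 4 (?j + 1) 1 (?k + 1) 2 else ?P ?i 4 ?j 5 (?k + 1) 2"
      using assms(1) by (auto simp: defs)
    then show ?thesis by (metis (full_types))
  qed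
qed


subsection \<open>The supersequence\<close>

lemma split_first_in:
  assumes "set p \<inter> S \<noteq> {}"
  obtains us a vs where "p = us @ a # vs" "a \<in> S" "set us \<inter> S = {}"
  using split_list_first_prop[of p "\<lambda>x. x \<in> S"] assms by blast

lemma split_at_three:
  assumes "distinct p" "set p \<supseteq> S" "card S = 3"
  obtains us0 a us1 b us2 c us3 where "p = us0 @ a # us1 @ b # us2 @ c # us3" "S = {a, b, c}"
proof -
  have fin: "finite S" using assms(3) by (simp add: card_ge_0_finite)
  have "S \<noteq> {}" using assms(3) by auto
  with assms(2) have "set p \<inter> S \<noteq> {}" by blast
  then obtain us0 a p1 where p: "p = us0 @ a # p1" "a \<in> S" "set us0 \<inter> S = {}"
    by (rule split_first_in)
  define S1 where "S1 = S - {a}"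
  have S1: "card S1 = 2" "S1 \<subseteq> set p1" using assms p fin by (auto simp: S1_def)
  then have "set p1 \<inter> S1 \<noteq> {}" by (metis Int_absorb1 card.empty zero_neq_numeral)
  then obtain us1 b p2 where p1: "p1 = us1 @ b # p2" "b \<in> S1" "set us1 \<inter> S1 = {}"
    by (rule split_first_in)
  define S2 where "S2 = S1 - {b}"
  have S2: "card S2 = 1" "S2 \<subseteq> set p2" using S1 p1 by (auto simp: S2_def)
  then obtain c where c: "S2 = {c}" by (auto simp: card_1_singleton_iff)
  with S2(2) obtain us2 us3 where p2: "p2 = us2 @ c # us3" by (auto dest: split_list)
  have "S = {a, b, c}" using p(2) p1(2) c by (auto simp: S1_def S2_def)
  with p(1) p1(1) p2 show ?thesis by (intro that) auto
qed

lemma supersequence_three_specials: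
  fixes xs ys :: "'a list"
  assumes "N \<ge> 4" "length xs = N + 1" "length ys = 3" "distinct (ys @ xs)"
  shows "\<exists>w. supersequence (set (ys @ xs)) w
    \<and> 2 * length w \<le> 2 * ((N + 2) * N + 6) + 7 * (N + 3)"
proof -
  define sp where "sp q = map ((!) ys) (filter (\<lambda>e. q \<in> spots N e) [0..<3])" for q
  define c where "c = (\<lambda>t. xs ! (t mod length xs))"
  \<comment> \<open>The last special is read by slot 5 of its latest tick, and the final run adds
    one position and its own ticks: \<open>N + 1\<close> letters and one delay make
    \<open>N + 2\<close> ticks, with offset 6.\<close>
  define L where "L = (N + 2) * N + 6"
  let ?w = "interleave sp c L"
  have sp_in: "set (sp q) \<subseteq> set ys" for q using assms(3) by (auto simp: sp_def)
  have c_in: "c t \<in> set xs" for t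
    unfolding c_def by (rule nth_mem) (use assms(2) in \<open>auto intro!: mod_less_divisor\<close>)
  have "subseq p ?w" if "p \<in> permutations_of_set (set (ys @ xs))" for p
  proof -
    have p: "distinct p" "set p = set xs \<union> set ys"
      using that by (auto simp: permutations_of_set_def)
    have card: "card (set ys) = 3" using assms(3,4) by (simp add: distinct_card)
    obtain us0 a us1 b us2 d us3 where split: "p = us0 @ a # us1 @ b # us2 @ d # us3"
      and ys: "set ys = {a, b, d}"
      using split_at_three[OF p(1) _ card] p(2) by blast
    have "length p = N + 4"
    proof -
      have "set p = set (ys @ xs)" using p(2) by auto
      then have "length p = length (ys @ xs)"
        using distinct_card[OF p(1)] distinct_card[OF assms(4)] by simp
      then show ?thesis using assms(2,3) by simp
    qed
    then have len: "length us0 + length us1 + length us2 + length us3 = N + 1"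
      by (simp add: split)
    have us: "distinct us" "set us \<subseteq> set xs" if "us \<in> {us0, us1, us2, us3}" for us
      using that p ys unfolding split by auto
    have idx: "\<exists>e<3. ys ! e = x" if "x \<in> set ys" for x
      using that assms(3) by (auto simp: in_set_conv_nth)
    obtain e0 e1 e2 where e: "e0 < 3" "ys ! e0 = a" "e1 < 3" "ys ! e1 = b" "e2 < 3" "ys ! e2 = d"
      using idx ys by (metis insertI1 insertI2)
    have "a \<noteq> b" "b \<noteq> d" "a \<noteq> d" using p(1) unfolding split by auto
    then have "e0 \<noteq> e1" "e1 \<noteq> e2" "e0 \<noteq> e2" using e by auto
    then have E: "{e0, e1, e2} = {0, 1, 2}" using e(1,3,5) by auto
    let ?r0 = "length us0" and ?r1 = "length us1" and ?r2 = "length us2" and ?r3 = "length us3"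
    obtain i s j t k u where S: "s \<in> slots e0 i" "t \<in> slots e1 j" "u \<in> slots e2 k"
      and le: "?r0 * N + 1 \<le> i * N + s" "i * N + s + 1 + ?r1 * N \<le> j * N + t"
        "j * N + t + 1 + ?r2 * N \<le> k * N + u"
        "k * N + u \<le> (?r0 + ?r1 + ?r2 + 1) * N + 5"
      and tick: "i \<le> ?r0 + ?r1 + ?r2 + 1" "j \<le> ?r0 + ?r1 + ?r2 + 1" "k \<le> ?r0 + ?r1 + ?r2 + 1"
      using slots_schedule[OF assms(1) E, of ?r0 ?r1 ?r2] by blast
    have "(?r0 + ?r1 + ?r2 + 1) + ?r3 = N + 2" using len by simp
    then have "(?r0 + ?r1 + ?r2 + 1) * N + ?r3 * N = (N + 2) * N" by (metis add_mult_distrib)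
    then have final: "k * N + u + 1 + ?r3 * N \<le> L" using le(4) by (simp add: L_def)
    have in_sp: "ys ! e \<in> set (sp q)" if "e < 3" "q \<in> spots N e" for e q
      using that by (auto simp: sp_def)
    have special: "a \<in> set (sp (i * N + s))" "b \<in> set (sp (j * N + t))" "d \<in> set (sp (k * N + u))"
      using in_sp[OF e(1) spotsI[OF S(1)]] in_sp[OF e(3) spotsI[OF S(2)]]
        in_sp[OF e(5) spotsI[OF S(3)]] tick len e by auto
    have run: "subseq us (map c [q..<q + 1 + length us * N])" if "us \<in> {us0, us1, us2, us3}" for us q
      using cyclic_subseq[OF us[OF that], of q] assms(2) by (simp add: c_def)
    have step: "subseq (v @ x # us) (interleave sp c (q + 1 + length us * N))"
      if "subseq v (interleave sp c q')" "q' \<le> q" "x \<in> set (sp q)" "us \<in> {us0, us1, us2, us3}"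
      for v x us q q'
      using interleave_ordinary[OF interleave_special[OF that(1-3)] _ run[OF that(4)]] by simp
    have "subseq us0 (map c [0..<?r0 * N + 1])" using run[of us0 0] by (simp add: add.commute)
    then have "subseq us0 (interleave sp c (?r0 * N + 1))"
      unfolding interleave_def using subseq_concat_chunks subseq_order.trans by blast
    then have "subseq (us0 @ a # us1) (interleave sp c (i * N + s + 1 + ?r1 * N))"
      by (rule step) (use le special in auto)
    then have "subseq ((us0 @ a # us1) @ b # us2) (interleave sp c (j * N + t + 1 + ?r2 * N))"
      by (rule step) (use le special in auto)
    then have "subseq (((us0 @ a # us1) @ b # us2) @ d # us3)
        (interleave sp c (k * N + u + 1 + ?r3 * N))"
      by (rule step) (use le special in auto)
    then show ?thesis using final by (simp add: split interleave_extend)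
  qed
  moreover have "set ?w \<subseteq> set (ys @ xs)" using sp_in c_in by (fastforce simp: interleave_def)
  ultimately have "supersequence (set (ys @ xs)) ?w" by (simp add: supersequence_def)
  moreover have "2 * length ?w \<le> 2 * L + 7 * (N + 3)"
  proof -
    \<comment> \<open>The inserted letters are counted separately for each special, by exchanging
      the sums over positions and specials.\<close>
    have indicator: "(\<Sum>t<L. if t \<in> spots N e then 1 else 0) \<le> card (spots N e)" for e
      using finite_spots[of N e] by (auto simp: sum.If_cases intro!: card_mono)
    have "length (sp t) = (\<Sum>e<3. if t \<in> spots N e then 1 else 0)" for t
      by (simp add: sp_def eval_nat_numeral)
    then have "(\<Sum>t<L. length (sp t)) = (\<Sum>e<3. \<Sum>t<L. if t \<in> spots N e then 1 else 0)"
      by (simp add: sum.swap[of _ "{..<L}"])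
    also have "\<dots> \<le> (\<Sum>e<3. card (spots N e))" by (intro sum_mono indicator)
    also have "\<dots> = card (spots N 0) + card (spots N 1) + card (spots N 2)"
      by (simp add: eval_nat_numeral)
    finally show ?thesis using card_spots[of N] by (simp add: length_interleave)
  qed
  ultimately show ?thesis unfolding L_def by blast
qed

section \<open>Numerical comparison with the required length\<close>

theorem theorem28:
  fixes m :: nat and A :: "'a set"
  assumes "m > 0" and "finite A" and "card A = m"
  shows "\<exists>w. supersequence A w \<and>
           int (length w) =
             \<lceil>real m ^ 2 - 5 / 2 * real m + 3 / 2 * (real m / 2) powr (2 / 3)
               + (real m / 2) powr (1 / 3) + 7\<rceil>"
proof -
  define k where "k = (real m / 2) powr (1 / 3)"
  define B where "B = real m ^ 2 - 5 / 2 * real m + 3 / 2 * k ^ 2 + k + 7"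
  have k2: "(real m / 2) powr (2 / 3) = k ^ 2"
    using assms(1) by (simp add: k_def powr_power)
  have k3: "k ^ 3 = real m / 2"
    using assms(1) by (simp add: k_def powr_power)
  have k0: "k \<ge> 0" by (simp add: k_def)
  obtain a where a: "a \<in> A" using assms by fastforce
  have "\<exists>w. supersequence A w \<and> real (length w) \<le> B"
  proof (cases "m \<le> 7")
    case True
    obtain w where w: "supersequence A w" "length w = 1 + m * (m - 1)"
      using supersequence_cyclic[OF assms(2)] a assms(3) by blast
    have "real (length w) = real m ^ 2 - real m + 1"
      using w(2) assms(1) by (simp add: of_nat_diff power2_eq_square algebra_simps)
    moreover have "3 / 2 * real m \<le> 3 / 2 * k ^ 2 + k + 6"
    proof -
      \<comment> \<open>The value 38/25 lies just above the cube root of 7/2.\<close>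
      have "k \<le> 38 / 25"
      proof (rule ccontr)
        assume "\<not> k \<le> 38 / 25"
        then have "(38 / 25) ^ 3 < k ^ 3" by (intro power_strict_mono) auto
        then show False using k3 True by (simp add: power3_eq_cube)
      qed
      \<comment> \<open>The coefficient 153/50 makes the product agree with
        \<open>3 / 2 * k ^ 2 - 3 * k ^ 3\<close> in its two top terms; the bound on \<open>k\<close>
        settles the linear remainder.\<close>
      then have "0 \<le> (38 / 25 - k) * (3 * k ^ 2 + 153 / 50 * k + 3)"
        using k0 by (intro mult_nonneg_nonneg add_nonneg_nonneg) auto
      then have "3 * k ^ 3 \<le> 3 / 2 * k ^ 2 + k + 6"
        using \<open>k \<le> 38 / 25\<close> by (simp add: power2_eq_square power3_eq_cube field_simps)
      then show ?thesis using k3 by simp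
    qed
    ultimately show ?thesis using w(1) by (intro exI[of _ w]) (simp add: B_def)
  next
    case False
    obtain zs where zs: "set zs = A" "distinct zs" using finite_distinct_list[OF assms(2)] by auto
    then have len: "length zs = m" using assms(3) distinct_card by fastforce
    define N where "N = m - 4"
    have N: "m = N + 4" "N \<ge> 4" using False by (auto simp: N_def)
    obtain w where w: "supersequence A w" "2 * length w \<le> 2 * ((N + 2) * N + 6) + 7 * (N + 3)"
      using supersequence_three_specials[of N "drop 3 zs" "take 3 zs",
          unfolded append_take_drop_id] zs len N by auto
    have "real (2 * length w) \<le> real (2 * ((N + 2) * N + 6) + 7 * (N + 3))"
      using w(2) by (simp only: of_nat_le_iff)
    then have "real (length w) \<le> real m ^ 2 - 5 / 2 * real m + 21 / 2"
      by (simp add: N(1) power2_eq_square field_simps)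
    \<comment> \<open>Since \<open>m >= 8\<close>, \<open>k ^ 3 >= 4 > 27/8\<close>. Then
      \<open>3 / 2 * k ^ 2 + k + 7\<close> is at least 95/8, which exceeds the needed 21/2.\<close>
    moreover have "k \<ge> 3 / 2"
    proof (rule ccontr)
      assume "\<not> k \<ge> 3 / 2"
      then have "k ^ 3 < (3 / 2) ^ 3" using k0 by (intro power_strict_mono) auto
      then show False using k3 False by (simp add: power3_eq_cube)
    qed
    then have "k ^ 2 \<ge> (3 / 2) ^ 2" by (intro power_mono) auto
    then have "k ^ 2 \<ge> 9 / 4" by (simp add: power2_eq_square)
    ultimately show ?thesis using w(1) \<open>k \<ge> 3 / 2\<close> by (intro exI[of _ w]) (simp add: B_def)
  qed
  then obtain w where w: "supersequence A w" "real (length w) \<le> B" by blast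
  have "int (length w) \<le> \<lceil>B\<rceil>" using w(2) by linarith
  then have "length w \<le> nat \<lceil>B\<rceil>" "int (nat \<lceil>B\<rceil>) = \<lceil>B\<rceil>" by linarith+
  with supersequence_pad[OF w(1) a, of "nat \<lceil>B\<rceil>"] show ?thesis
    by (auto simp: B_def k2 simp flip: k_def)
qed

end
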